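(* Let $X$ be a complete geodesic metric space containing at least two points and let $\mathcal C$ be a non-empty set of global cut-points of $X$. (a) There exists the largest (in the sense of $\prec$) collection $\mathcal P$ of subsets of $X$ such that: $X$ is tree-graded with respect to $\mathcal P$; and any piece in $\mathcal P$ is either a singleton or a set with no global cut-point from $\mathcal C$. Moreover the intersection of any two distinct pieces from $\mathcal P$ is either empty or a point from $\mathcal C$. (b) Let $X$ be a homogeneous space with a cut-point. Then every point in $X$ is a cut-point, so let $\mathcal C=X$. Let $\mathcal P$ be the set of pieces defined in part (a). Then for every $M\in\mathcal P$, every $x\in M$ is the projection of a point $y\in X\setminus M$ onto $M$.
   Context: A complete geodesic metric space $X$ is tree-graded with respect to a collection $\mathcal P$ of closed geodesic subsets (pieces; a subset is geodesic if any two of its points are joined by a geodesic contained in it) if $(T_1)$ every two different pieces have at most one common point, and $(T_2)$ every simple geodesic triangle (simple loop composed of three geodesics) is contained in one piece. A point is regarded as a geodesic triangle with sides of length $0$, so pieces cover $X$. It is assumed that pieces do not contain other pieces. If $X$ is tree-graded with respect to both $\mathcal P$ and $\mathcal P'$, write $\mathcal P\prec\mathcal P'$ if every $M\in\mathcal P$ is contained in some $M'\in\mathcal P'$; this is a partial order. "Largest" means that every collection $\mathcal P'$ with the stated two properties satisfies $\mathcal P'\prec\mathcal P$. A (global) cut-point of a path connected space $Y$ is a point $c\in Y$ such that $Y\setminus\{c\}$ is not path connected; by convention a one-point space has a cut-point. A piece $M$ has no global cut-point from $\mathcal C$ if no point of $\mathcal C\cap M$ is a cut-point of $M$. A metric space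 is homogeneous if its isometry group acts transitively. In a tree-graded space, for every piece $M$ and every $y\in X$ there is a unique $x\in M$ with $\mathrm{dist}(y,M)=\mathrm{dist}(y,x)$, called the projection of $y$ onto $M$. *)

theory Defs
  imports "HOL-Analysis.Analysis"
begin

text \<open>The ambient space \<open>X\<close> is a whole type of class \<open>metric_space\<close>; completeness is imposed in
  the theorem through the class \<open>complete_space\<close>.\<close>

text \<open>A geodesic is an isometric embedding of an interval \<open>[0, L]\<close>; rescaling the interval to
  \<open>[0, 1]\<close> makes it a path in the sense of the library. \<open>L = 0\<close> gives the constant geodesics.\<close>

definition geodesic_path :: "(real \<Rightarrow> 'a::metric_space) \<Rightarrow> bool" where
  "geodesic_path g \<longleftrightarrow>
     (\<exists>L\<ge>0. \<forall>s\<in>{0..1}. \<forall>t\<in>{0..1}. dist (g s) (g t) = L * \<bar>s - t\<bar>)"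

definition geodesic_set :: "'a::metric_space set \<Rightarrow> bool" where
  "geodesic_set S \<longleftrightarrow>
     (\<forall>x\<in>S. \<forall>y\<in>S. \<exists>g. geodesic_path g \<and> pathstart g = x \<and> pathfinish g = y \<and> path_image g \<subseteq> S)"

text \<open>A triangle is identified with the set of its points. The disjunct \<open>T = {a}\<close> is the convention
  that a point is a triangle with sides of length \<open>0\<close>; it is needed separately because
  \<open>simple_path\<close> excludes constant subpaths. A simple bigon, i.e. a triangle with
  exactly one side of length \<open>0\<close>, is covered by the other disjunct: place the third vertex in the
  interior of one of its two sides.\<close>

definition simple_geodesic_triangle :: "'a::metric_space set \<Rightarrow> bool" where
  "simple_geodesic_triangle T \<longleftrightarrow>
     (\<exists>a. T = {a}) \<or>
     (\<exists>g1 g2 g3. geodesic_path g1 \<and> geodesic_path g2 \<and> geodesic_path g3 \<and>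
        pathfinish g1 = pathstart g2 \<and> pathfinish g2 = pathstart g3 \<and>
        pathfinish g3 = pathstart g1 \<and>
        simple_path (g1 +++ g2 +++ g3) \<and> T = path_image (g1 +++ g2 +++ g3))"

text \<open>The third conjunct is the standing assumption that pieces do not contain other pieces; the last
  two are \<open>(T\<^sub>1)\<close> and \<open>(T\<^sub>2)\<close>.\<close>

definition tree_graded :: "'a::metric_space set set \<Rightarrow> bool" where
  "tree_graded P \<longleftrightarrow>
     geodesic_set (UNIV :: 'a set) \<and>
     (\<forall>M\<in>P. closed M \<and> geodesic_set M) \<and>
     (\<forall>M\<in>P. \<forall>N\<in>P. M \<subseteq> N \<longrightarrow> M = N) \<and>
     (\<forall>M\<in>P. \<forall>N\<in>P. M \<noteq> N \<longrightarrow> (\<forall>x\<in>M \<inter> N. \<forall>y\<in>M \<inter> N. x = y)) \<and>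
     (\<forall>T. simple_geodesic_triangle T \<longrightarrow> (\<exists>M\<in>P. T \<subseteq> M))"

definition finer :: "'a set set \<Rightarrow> 'a set set \<Rightarrow> bool" where
  "finer P P' \<longleftrightarrow> (\<forall>M\<in>P. \<exists>M'\<in>P'. M \<subseteq> M')"

text \<open>The disjunct \<open>Y = {c}\<close> is the convention that a one-point space has a cut-point; in the library
  the empty set is path connected.\<close>

definition cut_point :: "'a::topological_space set \<Rightarrow> 'a \<Rightarrow> bool" where
  "cut_point Y c \<longleftrightarrow> c \<in> Y \<and> (Y = {c} \<or> \<not> path_connected (Y - {c}))"

definition cut_free_grading :: "'a::metric_space set \<Rightarrow> 'a set set \<Rightarrow> bool" where
  "cut_free_grading C P \<longleftrightarrow>
     tree_graded P \<and> (\<forall>M\<in>P. (\<exists>x. M = {x}) \<or> (\<forall>c\<in>C \<inter> M. \<not> cut_point M c))"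

definition largest_cut_free_grading :: "'a::metric_space set \<Rightarrow> 'a set set \<Rightarrow> bool" where
  "largest_cut_free_grading C P \<longleftrightarrow>
     cut_free_grading C P \<and> (\<forall>P'. cut_free_grading C P' \<longrightarrow> finer P' P)"

definition homogeneous_space :: "'a::metric_space itself \<Rightarrow> bool" where
  "homogeneous_space _ \<longleftrightarrow>
     (\<forall>x y :: 'a. \<exists>f :: 'a \<Rightarrow> 'a. bij f \<and> (\<forall>u v. dist (f u) (f v) = dist u v) \<and> f x = y)"

text \<open>\<open>x\<close> is the unique point of \<open>M\<close> realising the distance from \<open>y\<close> to \<open>M\<close>.\<close>

definition is_projection :: "'a::metric_space set \<Rightarrow> 'a \<Rightarrow> 'a \<Rightarrow> bool" where
  "is_projection M y x \<longleftrightarrow> (\<forall>z. (z \<in> M \<and> infdist y M = dist y z) \<longleftrightarrow> z = x)"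

end

theory Submission
  imports Defs
begin

text \<open>
  Call a set \<^emph>\<open>unseparated\<close> if no point \<open>c\<close> of \<open>C\<close> separates two of its other points, i.e. puts
  them into different path components of \<open>X - {c}\<close>. The largest grading consists of the \<^emph>\<open>blocks\<close>,
  the maximal unseparated sets.

  Different blocks contain, by maximality, two points \<open>u\<close> and \<open>v\<close> that are separated by some \<open>c\<close> in
  \<open>C\<close>. A common point of the blocks must be \<open>c\<close>, since any other one would be joined to \<open>u\<close> and to
  \<open>v\<close> outside \<open>c\<close>. This gives \<open>(T\<^sub>1)\<close> and the claim about intersections
  (\<open>distinct_blocks_Int\<close>). A loop without self-intersections stays path connected when a
  point is removed, so it is unseparated and lies in a block, which gives \<open>(T\<^sub>2)\<close>.

  The key property is that an arc whose ends lie in a block stays in the block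
  (\<open>arc_in_block\<close>): deleting a point \<open>c\<close> from the arc leaves every other point of it joined to one of the
  two ends. Geodesics are arcs, so blocks are geodesic. Moreover, a path in
  \<open>X - {c}\<close> between two points of a block contains an arc between them, and this arc then avoids \<open>c\<close>
  inside the block; hence a point of \<open>C\<close> is never a cut-point of a block with
  more than one point (\<open>block_diff_path_connected\<close>).

  Conversely, a singleton and a geodesic set without cut-points in \<open>C\<close> are unseparated. So every
  grading by such sets is finer than the grading into blocks, which makes the latter the largest one.

  For part (b), isometries carry cut-points to cut-points, and for a singleton piece the projection
  is trivial. Let \<open>x\<close> be a point of a piece \<open>M\<close> with more than one point. Then \<open>M - {x}\<close> is path connected while
  \<open>X - {x}\<close> is not, so some point \<open>y\<close> lies in another path component of \<open>X - {x}\<close> than \<open>M - {x}\<close>.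
  All geodesics from \<open>y\<close> to \<open>M\<close> pass through \<open>x\<close>, which is therefore the projection of \<open>y\<close>.
\<close>

section \<open>Arcs in metric spaces\<close>

text \<open>The Kuratowski embedding: the distance functions of two points differ by a bounded function, so
  subtracting a fixed distance function embeds a metric space isometrically into a Banach space. It
  serves to carry results on arcs in Banach spaces over to metric spaces.\<close>

lemma isometric_embedding_bcontfun:
  "\<exists>k :: 'a::metric_space \<Rightarrow> ('a \<Rightarrow>\<^sub>C real). \<forall>x y. dist (k x) (k y) = dist x y"
proof -
  fix a :: 'a
  define k :: "'a \<Rightarrow> ('a \<Rightarrow>\<^sub>C real)" where "k x = Bcontfun (\<lambda>z. dist x z - dist a z)" for x
  have diff: "\<bar>dist x z - dist y z\<bar> \<le> dist x y" for x y z :: 'a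
    using abs_dist_diff_le[of x z y] by (simp add: dist_commute[of z])
  have "(\<lambda>z. dist x z - dist a z) \<in> bcontfun" for x
    by (rule bcontfun_normI[where b = "dist x a"])
       (auto intro!: continuous_intros simp: diff)
  then have k: "apply_bcontfun (k x) z = dist x z - dist a z" for x z
    by (simp add: k_def Bcontfun_inverse)
  have "dist (k x) (k y) = dist x y" for x y
  proof (rule antisym)
    show "dist (k x) (k y) \<le> dist x y"
      by (rule dist_bound) (simp add: k dist_real_def diff)
    \<comment> \<open>The supremum is attained by evaluation at \<open>y\<close>.\<close>
    show "dist x y \<le> dist (k x) (k y)"
      using dist_bounded[of "k x" y "k y"] by (simp add: k dist_real_def)
  qed
  then show ?thesis by blast
qed

lemma path_component_contains_arc:
  fixes x y :: "'a::metric_space"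
  assumes "path_component S x y" "x \<noteq> y"
  obtains q where "arc q" "path_image q \<subseteq> S" "pathstart q = x" "pathfinish q = y"
proof -
  obtain k :: "'a \<Rightarrow> ('a \<Rightarrow>\<^sub>C real)" where k: "\<And>x y. dist (k x) (k y) = dist x y"
    using isometric_embedding_bcontfun by blast
  have inj: "inj k"
    by (metis dist_eq_0_iff injI k)
  have cont: "continuous_on A k" for A
    by (auto simp: continuous_on_iff k)
  have cont_inv: "continuous_on (range k) (inv k)"
    using k by (force simp: continuous_on_iff inj)
  obtain p where p: "path p" "path_image p \<subseteq> S" "pathstart p = x" "pathfinish p = y"
    using assms(1) by (auto simp: path_component_def)
  have "path (k \<circ> p)"
    using p(1) cont by (rule path_continuous_image)
  moreover have "k x \<noteq> k y"
    using assms(2) inj by (simp add: inj_eq)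
  ultimately obtain q where q: "arc q" "path_image q \<subseteq> path_image (k \<circ> p)"
      "pathstart q = k x" "pathfinish q = k y"
    using path_contains_arc[of "k \<circ> p" "k x" "k y"] p by (auto simp: pathstart_compose pathfinish_compose)
  have qk: "path_image q \<subseteq> k ` path_image p"
    using q(2) by (simp add: path_image_compose)
  show thesis
  proof
    show "arc (inv k \<circ> q)"
      unfolding arc_def
    proof
      show "path (inv k \<circ> q)"
        using q(1) qk by (intro path_continuous_image continuous_on_subset[OF cont_inv]) (auto simp: arc_imp_path)
      show "inj_on (inv k \<circ> q) {0..1}"
        using q(1) qk by (intro comp_inj_on inj_on_subset[OF inj_on_inv_into[OF subset_refl]])
           (auto simp: arc_def path_image_def)
    qed
    show "path_image (inv k \<circ> q) \<subseteq> S"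
      using qk p(2) inj by (force simp: path_image_compose)
    show "pathstart (inv k \<circ> q) = x" "pathfinish (inv k \<circ> q) = y"
      using q inj by (auto simp: pathstart_compose pathfinish_compose)
  qed
qed

lemma path_component_path_connected:
  assumes "path_connected T" "x \<in> T" "y \<in> T" "T \<subseteq> S"
  shows "path_component S x y"
  using assms path_component_of_subset path_connected_component by metis

lemma path_connected_simple_loop_diff:
  fixes p :: "real \<Rightarrow> 'a::t2_space"
  assumes "simple_path p" "pathfinish p = pathstart p"
  shows "path_connected (path_image p - {c})"
proof (cases "c \<in> path_image p")
  case True
  then obtain u where u: "u \<in> {0..1}" "p u = c"
    by (auto simp: path_image_def)
  \<comment> \<open>Reparametrise the loop so that it starts at the deleted point.\<close>
  define q where "q = shiftpath u p"
  have q: "simple_path q" "path_image q = path_image p" "pathstart q = c" "pathfinish q = c"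
    using assms u by (auto simp: q_def simple_path_shiftpath path_image_shiftpath
        pathstart_shiftpath pathfinish_shiftpath)
  have "path_image p - {c} = q ` {0<..<1}"
    using simple_path_endless[OF q(1)] q by auto
  moreover have "path_connected (q ` {0<..<1})"
  proof (rule path_connected_continuous_image)
    show "continuous_on {0<..<1} q"
      using q(1) by (auto simp: simple_path_def path_def intro: continuous_on_subset)
  qed (simp add: convex_imp_path_connected)
  ultimately show ?thesis by simp
next
  case False
  then show ?thesis
    using assms path_connected_path_image simple_path_imp_path by fastforce
qed

section \<open>Geodesics\<close>

lemma geodesic_path_continuous:
  assumes "geodesic_path g"
  shows "path g"
proof -
  obtain L where L: "L \<ge> 0" "\<And>s t. s \<in> {0..1} \<Longrightarrow> t \<in> {0..1} \<Longrightarrow> dist (g s) (g t) = L * \<bar>s - t\<bar>"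
    using assms by (auto simp: geodesic_path_def)
  have "L-lipschitz_on {0..1} g"
    using L by (auto intro!: lipschitz_onI simp: dist_real_def)
  then show ?thesis
    by (simp add: path_def lipschitz_on_continuous_on)
qed

lemma geodesic_path_arc:
  assumes "geodesic_path g" "pathstart g \<noteq> pathfinish g"
  shows "arc g"
proof -
  obtain L where L: "L \<ge> 0" "\<And>s t. s \<in> {0..1} \<Longrightarrow> t \<in> {0..1} \<Longrightarrow> dist (g s) (g t) = L * \<bar>s - t\<bar>"
    using assms by (auto simp: geodesic_path_def)
  have "L \<noteq> 0"
    using L(2)[of 0 1] assms(2) by (auto simp: pathstart_def pathfinish_def)
  then have "inj_on g {0..1}"
    using L(2) by (intro inj_onI) (metis abs_eq_0 dist_self eq_iff_diff_eq_0 mult_eq_0_iff)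
  then show ?thesis
    using assms(1) by (simp add: arc_def geodesic_path_continuous)
qed

lemma geodesic_path_dist_add:
  assumes "geodesic_path g" "x \<in> path_image g"
  shows "dist (pathstart g) (pathfinish g) = dist (pathstart g) x + dist x (pathfinish g)"
proof -
  obtain L where L: "L \<ge> 0" "\<And>s t. s \<in> {0..1} \<Longrightarrow> t \<in> {0..1} \<Longrightarrow> dist (g s) (g t) = L * \<bar>s - t\<bar>"
    using assms by (auto simp: geodesic_path_def)
  obtain t where t: "t \<in> {0..1}" "x = g t"
    using assms(2) by (auto simp: path_image_def)
  show ?thesis
    using L(2)[of 0 1] L(2)[of 0 t] L(2)[of t 1] t
    by (simp add: pathstart_def pathfinish_def algebra_simps)
qed

lemma geodesic_set_path_connected:
  assumes "geodesic_set S"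
  shows "path_connected S"
  using assms geodesic_path_continuous unfolding geodesic_set_def path_connected_def by metis

lemma ball_path_component:
  fixes x y :: "'a::metric_space"
  assumes "geodesic_set (UNIV :: 'a set)" "dist x y < dist x c"
  shows "path_component (- {c}) x y"
proof -
  obtain g where g: "geodesic_path g" "pathstart g = x" "pathfinish g = y"
    using assms(1) by (auto simp: geodesic_set_def)
  have "c \<notin> path_image g"
    using geodesic_path_dist_add[OF g(1), of c] assms(2) g(2,3) zero_le_dist[of c y] by auto
  then show ?thesis
    using g geodesic_path_continuous[OF g(1)] by (auto simp: path_component_def)
qed

lemma dist_add_if_separated:
  fixes x y z :: "'a::metric_space"
  assumes "geodesic_set (UNIV :: 'a set)" "\<not> path_component (- {x}) y z"
  shows "dist y z = dist y x + dist x z"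
proof -
  obtain g where g: "geodesic_path g" "pathstart g = y" "pathfinish g = z"
    using assms(1) by (auto simp: geodesic_set_def)
  have "x \<in> path_image g"
    using assms(2) g geodesic_path_continuous[OF g(1)] by (auto simp: path_component_def)
  then show ?thesis
    using geodesic_path_dist_add[OF g(1)] g by auto
qed

section \<open>Unseparated sets and blocks\<close>

definition unseparated :: "'a::topological_space set \<Rightarrow> 'a set \<Rightarrow> bool" where
  "unseparated C S \<longleftrightarrow> (\<forall>c\<in>C. \<forall>x\<in>S - {c}. \<forall>y\<in>S - {c}. path_component (- {c}) x y)"

definition blocks :: "'a::topological_space set \<Rightarrow> 'a set set" where
  "blocks C = {M. unseparated C M \<and> (\<forall>N. unseparated C N \<and> M \<subseteq> N \<longrightarrow> N = M)}"

lemma unseparatedD: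
  "unseparated C S \<Longrightarrow> c \<in> C \<Longrightarrow> x \<in> S \<Longrightarrow> y \<in> S \<Longrightarrow> x \<noteq> c \<Longrightarrow> y \<noteq> c \<Longrightarrow> path_component (- {c}) x y"
  by (auto simp: unseparated_def)

lemma unseparated_if_path_connected_diff:
  assumes "\<And>c. c \<in> C \<Longrightarrow> path_connected (S - {c})"
  shows "unseparated C S"
  using assms unfolding unseparated_def by (auto intro!: path_component_path_connected[of "S - {_}"])

lemma unseparated_singleton: "unseparated C {x}"
  by (auto simp: unseparated_def path_component_refl)

lemma unseparated_insert:
  assumes "unseparated C M"
    and "\<And>c m. c \<in> C \<Longrightarrow> z \<noteq> c \<Longrightarrow> m \<in> M \<Longrightarrow> m \<noteq> c \<Longrightarrow> path_component (- {c}) z m"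
  shows "unseparated C (insert z M)"
  using assms unfolding unseparated_def by (auto intro: path_component_sym path_component_refl)

lemma block_unseparated: "M \<in> blocks C \<Longrightarrow> unseparated C M"
  by (simp add: blocks_def)

lemma block_maximal: "M \<in> blocks C \<Longrightarrow> unseparated C N \<Longrightarrow> M \<subseteq> N \<Longrightarrow> N = M"
  by (simp add: blocks_def)

lemma unseparated_subset_block:
  assumes "unseparated C S"
  shows "\<exists>M\<in>blocks C. S \<subseteq> M"
proof -
  let ?A = "{N. unseparated C N \<and> S \<subseteq> N}"
  have max: "\<exists>M\<in>?A. \<forall>N\<in>?A. M \<subseteq> N \<longrightarrow> N = M"
  proof (rule subset_Zorn_nonempty)
    show "?A \<noteq> {}"
      using assms by blast
    fix K assume K: "K \<noteq> {}" "subset.chain ?A K"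
    have mem: "\<And>N. N \<in> K \<Longrightarrow> unseparated C N \<and> S \<subseteq> N"
      and chain: "\<And>M N. M \<in> K \<Longrightarrow> N \<in> K \<Longrightarrow> M \<subseteq> N \<or> N \<subseteq> M"
      using K(2) unfolding subset_chain_def by auto
    have "unseparated C (\<Union> K)"
      unfolding unseparated_def
    proof (intro ballI)
      fix c x y assume c: "c \<in> C" and xy: "x \<in> \<Union> K - {c}" "y \<in> \<Union> K - {c}"
      then obtain M N where MN: "M \<in> K" "x \<in> M" "N \<in> K" "y \<in> N"
        by auto
      then obtain L where "L \<in> K" "x \<in> L" "y \<in> L"
        using chain[of M N] by blast
      then show "path_component (- {c}) x y"
        using mem c xy unseparatedD[of C L c x y] by blast
    qed
    moreover have "S \<subseteq> \<Union> K"
      using K(1) mem by blast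
    ultimately show "\<Union> K \<in> ?A"
      by simp
  qed
  obtain M where M: "M \<in> ?A" and max: "\<forall>N\<in>?A. M \<subseteq> N \<longrightarrow> N = M"
    using max by (rule bexE)
  then have "N = M" if "unseparated C N" "M \<subseteq> N" for N
    using that by (simp add: subset_trans[of S M N])
  then have "M \<in> blocks C"
    using M by (simp add: blocks_def)
  then show ?thesis
    using M by auto
qed

lemma block_nonempty: "M \<in> blocks C \<Longrightarrow> M \<noteq> {}"
  using block_maximal unseparated_singleton by blast

text \<open>This is the way in which maximality is exploited: to belong to a block, a point only needs,
  for every \<open>c\<close> in \<open>C\<close>, to be linked in the complement of \<open>c\<close> to one point of the block, because the
  latter is itself linked to all the others.\<close>

lemma in_blockI:
  assumes "M \<in> blocks C"
    and link: "\<And>c. c \<in> C \<Longrightarrow> z \<noteq> c \<Longrightarrow> \<exists>m \<in> M. m \<noteq> c \<and> path_component (- {c}) z m"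
  shows "z \<in> M"
proof -
  have "unseparated C (insert z M)"
  proof (rule unseparated_insert[OF block_unseparated[OF assms(1)]])
    fix c m assume *: "c \<in> C" "z \<noteq> c" "m \<in> M" "m \<noteq> c"
    then obtain m' where "m' \<in> M" "m' \<noteq> c" "path_component (- {c}) z m'"
      using link by blast
    then show "path_component (- {c}) z m"
      using * unseparatedD[OF block_unseparated[OF assms(1)]] path_component_trans by metis
  qed
  then show ?thesis
    using block_maximal[OF assms(1)] by blast
qed

lemma distinct_blocks_Int:
  assumes "M \<in> blocks C" "N \<in> blocks C" "M \<noteq> N" "x \<in> M \<inter> N"
  shows "x \<in> C" "M \<inter> N = {x}"
proof -
  have "\<not> N \<subseteq> M"
    using assms block_maximal[OF assms(2) block_unseparated[OF assms(1)]] by blast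
  then obtain u where u: "u \<in> N" "u \<notin> M"
    by blast
  \<comment> \<open>Some \<open>c\<close> cuts \<open>u\<close> off from \<open>M\<close>. As \<open>u\<close> lies in \<open>N\<close>, common points of \<open>M\<close> and \<open>N\<close> other than \<open>c\<close>
    would be linked to \<open>u\<close>.\<close>
  then obtain c where c: "c \<in> C" "u \<noteq> c" "\<And>m. m \<in> M \<Longrightarrow> m \<noteq> c \<Longrightarrow> \<not> path_component (- {c}) u m"
    using in_blockI[OF assms(1)] by metis
  have "v = c" if "v \<in> M \<inter> N" for v
    using that c u unseparatedD[OF block_unseparated[OF assms(2)]] by blast
  then show "x \<in> C" "M \<inter> N = {x}"
    using assms(4) c(1) by auto
qed

text \<open>A point \<open>z\<close> of the arc splits it into two subarcs meeting only in \<open>z\<close>. So a point \<open>c\<close> other than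
  \<open>z\<close> lies on at most one of them, and the other one links \<open>z\<close> to an end.\<close>

lemma arc_in_block:
  assumes "M \<in> blocks C" "arc g" "pathstart g \<in> M" "pathfinish g \<in> M"
  shows "path_image g \<subseteq> M"
proof
  fix z assume "z \<in> path_image g"
  then obtain t where t: "t \<in> {0..1}" "z = g t"
    by (auto simp: path_image_def)
  have inj: "inj_on g {0..1}" and cont: "continuous_on {0..1} g"
    using assms(2) by (auto simp: arc_def path_def)
  have pc: "path_connected (g ` {a..b})" if "0 \<le> a" "b \<le> 1" for a b
    using that by (intro path_connected_continuous_image continuous_on_subset[OF cont])
      (auto simp: convex_imp_path_connected)
  show "z \<in> M"
  proof (rule in_blockI[OF assms(1)])
    fix c assume c: "c \<in> C" "z \<noteq> c"
    show "\<exists>m\<in>M. m \<noteq> c \<and> path_component (- {c}) z m"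
    proof (cases "c \<in> g ` {0..t}")
      case False
      have "path_component (- {c}) z (g 0)"
        using False t by (intro path_component_path_connected[OF pc[of 0 t]]) auto
      then show ?thesis
        using False t assms(3) by (force simp: pathstart_def)
    next
      case True
      then have *: "c \<notin> g ` {t..1}"
        using c(2) t inj_onD[OF inj] by fastforce
      then have "path_component (- {c}) z (g 1)"
        using t by (intro path_component_path_connected[OF pc[of t 1]]) auto
      then show ?thesis
        using * t assms(4) by (force simp: pathfinish_def)
    qed
  qed
qed

lemma block_diff_path_connected:
  fixes M :: "'a::metric_space set"
  assumes "M \<in> blocks C" "c \<in> C"
  shows "path_connected (M - {c})"
  unfolding path_connected_component
proof (intro ballI)
  fix x y assume xy: "x \<in> M - {c}" "y \<in> M - {c}"
  then have comp: "path_component (- {c}) x y"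
    using unseparatedD[OF block_unseparated[OF assms(1)] assms(2)] by auto
  show "path_component (M - {c}) x y"
  proof (cases "x = y")
    case False
    then obtain q where q: "arc q" "path_image q \<subseteq> - {c}" "pathstart q = x" "pathfinish q = y"
      using path_component_contains_arc[OF comp] by blast
    moreover have "path_image q \<subseteq> M"
      using arc_in_block[OF assms(1) q(1)] q(3,4) xy by auto
    ultimately have "path_image q \<subseteq> M - {c}"
      by blast
    then show ?thesis
      using q arc_imp_path unfolding path_component_def by blast
  qed (use xy in \<open>auto intro: path_component_refl\<close>)
qed

lemma geodesic_block:
  fixes M :: "'a::metric_space set"
  assumes "geodesic_set (UNIV :: 'a set)" "M \<in> blocks C"
  shows "geodesic_set M"
  unfolding geodesic_set_def
proof (intro ballI)
  fix x y assume xy: "x \<in> M" "y \<in> M"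
  obtain g where g: "geodesic_path g" "pathstart g = x" "pathfinish g = y"
    using assms(1) by (auto simp: geodesic_set_def)
  have "path_image g \<subseteq> M"
  proof (cases "x = y")
    case True
    then show ?thesis
      using geodesic_path_dist_add[OF g(1)] g(2,3) xy by (auto simp: dist_commute)
  next
    case False
    then show ?thesis
      using arc_in_block[OF assms(2) geodesic_path_arc[OF g(1)]] g xy by auto
  qed
  then show "\<exists>g. geodesic_path g \<and> pathstart g = x \<and> pathfinish g = y \<and> path_image g \<subseteq> M"
    using g by blast
qed

text \<open>A ball around a limit point of the block that misses \<open>c\<close> is path connected and links
  this point to the block.\<close>

lemma closed_block:
  fixes M :: "'a::metric_space set"
  assumes "geodesic_set (UNIV :: 'a set)" "M \<in> blocks C"
  shows "closed M"
proof -
  have "closure M \<subseteq> M"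
  proof
    fix x assume x: "x \<in> closure M"
    show "x \<in> M"
    proof (rule in_blockI[OF assms(2)])
      fix c assume c: "c \<in> C" "x \<noteq> c"
      then obtain m where m: "m \<in> M" "dist m x < dist x c"
        using x by (metis closure_approachable zero_less_dist_iff)
      moreover have "m \<noteq> c"
        using m by (auto simp: dist_commute)
      ultimately show "\<exists>m\<in>M. m \<noteq> c \<and> path_component (- {c}) x m"
        using ball_path_component[OF assms(1), of x m c] by (auto simp: dist_commute)
    qed
  qed
  then show ?thesis
    by (simp add: closure_subset_eq)
qed

lemma simple_geodesic_triangle_in_block:
  assumes "simple_geodesic_triangle T"
  shows "\<exists>M\<in>blocks C. T \<subseteq> M"
proof (rule unseparated_subset_block)
  show "unseparated C T"
  proof (cases "\<exists>a. T = {a}")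
    case False
    then show ?thesis
      using assms unfolding simple_geodesic_triangle_def
      by (auto intro!: unseparated_if_path_connected_diff path_connected_simple_loop_diff)
  qed (auto simp: unseparated_singleton)
qed

section \<open>The largest grading\<close>

lemma cut_free_grading_blocks:
  assumes "geodesic_set (UNIV :: 'a::metric_space set)"
  shows "cut_free_grading C (blocks C :: 'a set set)"
  unfolding cut_free_grading_def tree_graded_def
proof (intro conjI ballI allI impI)
  show "M = N" if "M \<in> blocks C" "N \<in> blocks C" "M \<subseteq> N" for M N :: "'a set"
    using that block_maximal block_unseparated by metis
  show "x = y" if "M \<in> blocks C" "N \<in> blocks C" "M \<noteq> N" "x \<in> M \<inter> N" "y \<in> M \<inter> N"
    for M N :: "'a set" and x y
    using that distinct_blocks_Int(2) by blast
  show "(\<exists>x. M = {x}) \<or> (\<forall>c\<in>C \<inter> M. \<not> cut_point M c)" if "M \<in> blocks C" for M :: "'a set"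
    using that block_diff_path_connected by (auto simp: cut_point_def)
qed (use assms closed_block geodesic_block simple_geodesic_triangle_in_block in auto)

lemma cut_free_grading_finer_blocks:
  assumes "cut_free_grading C P"
  shows "finer P (blocks C)"
  unfolding finer_def
proof (intro ballI unseparated_subset_block)
  fix M assume "M \<in> P"
  with assms have geo: "geodesic_set M" and M: "(\<exists>x. M = {x}) \<or> (\<forall>c\<in>C \<inter> M. \<not> cut_point M c)"
    by (auto simp: cut_free_grading_def tree_graded_def)
  show "unseparated C M"
  proof (cases "\<exists>x. M = {x}")
    case False
    show ?thesis
    proof (rule unseparated_if_path_connected_diff)
      fix c assume "c \<in> C"
      then show "path_connected (M - {c})"
        using M False geodesic_set_path_connected[OF geo] by (cases "c \<in> M") (auto simp: cut_point_def)
    qed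
  qed (auto simp: unseparated_singleton)
qed

lemma finer_antisym:
  assumes "tree_graded P" "tree_graded Q" "finer P Q" "finer Q P"
  shows "P = Q"
proof -
  have "A \<subseteq> B" if A: "tree_graded A" and AB: "finer A B" and BA: "finer B A" for A B :: "'a set set"
  proof
    fix M assume M: "M \<in> A"
    obtain N where N: "N \<in> B" "M \<subseteq> N"
      using M AB unfolding finer_def by blast
    obtain M' where M': "M' \<in> A" "N \<subseteq> M'"
      using N BA unfolding finer_def by blast
    have "M = M'"
      using A M N M' unfolding tree_graded_def by (meson subset_trans)
    then show "M \<in> B"
      using N M' by auto
  qed
  then show ?thesis
    using assms by blast
qed

lemma largest_cut_free_grading_iff_blocks:
  assumes "geodesic_set (UNIV :: 'a::metric_space set)"
  shows "largest_cut_free_grading C P \<longleftrightarrow> P = (blocks C :: 'a set set)"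
proof
  assume "largest_cut_free_grading C P"
  then show "P = blocks C"
    using finer_antisym cut_free_grading_blocks[OF assms] cut_free_grading_finer_blocks
    unfolding largest_cut_free_grading_def cut_free_grading_def by metis
next
  assume "P = blocks C"
  then show "largest_cut_free_grading C P"
    using cut_free_grading_blocks[OF assms] cut_free_grading_finer_blocks
    by (auto simp: largest_cut_free_grading_def)
qed

section \<open>Homogeneous spaces and projections\<close>

lemma cut_point_isometry:
  fixes f :: "'a::metric_space \<Rightarrow> 'a"
  assumes "bij f" and iso: "\<And>u v. dist (f u) (f v) = dist u v" and "cut_point UNIV x"
  shows "cut_point UNIV (f x)"
proof -
  have inv_iso: "dist (inv f u) (inv f v) = dist u v" for u v
    using iso assms(1) by (metis bij_inv_eq_iff)
  have image: "inv f ` (UNIV - {f x}) = UNIV - {x}"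
    using assms(1) by (simp add: image_set_diff bij_imp_bij_inv bij_is_inj bij_is_surj)
  have "path_connected (UNIV - {x})" if "path_connected (UNIV - {f x})"
    unfolding image[symmetric] using that
    by (rule path_connected_continuous_image[rotated]) (auto simp: continuous_on_iff inv_iso)
  moreover have "(UNIV :: 'a set) = {f x}" if "(UNIV :: 'a set) = {x}"
    using that by (metis UNIV_I singletonD)
  ultimately show ?thesis
    using assms(3) by (auto simp: cut_point_def)
qed

lemma homogeneous_cut_point:
  fixes c x :: "'a::metric_space"
  assumes "homogeneous_space TYPE('a)" "cut_point UNIV c"
  shows "cut_point UNIV x"
proof -
  obtain f :: "'a \<Rightarrow> 'a" where "bij f" "\<And>u v. dist (f u) (f v) = dist u v" "f c = x"
    using assms(1) unfolding homogeneous_space_def by blast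
  then show ?thesis
    using cut_point_isometry[of f c] assms(2) by simp
qed

lemma is_projectionI:
  assumes "x \<in> M" "\<And>z. z \<in> M \<Longrightarrow> z \<noteq> x \<Longrightarrow> dist y x < dist y z"
  shows "is_projection M y x"
proof -
  have "infdist y M = dist y x"
  proof (rule antisym)
    show "infdist y M \<le> dist y x"
      using assms(1) by (rule infdist_le)
    show "dist y x \<le> infdist y M"
      using assms by (auto simp: infdist_def intro!: cINF_greatest) (metis less_eq_real_def)
  qed
  then show ?thesis
    using assms unfolding is_projection_def by (metis less_irrefl)
qed

lemma cut_point_is_projection:
  fixes M :: "'a::metric_space set"
  assumes geo: "geodesic_set (UNIV :: 'a set)" and "\<exists>x y :: 'a. x \<noteq> y"
    and cut: "cut_point UNIV x" and "x \<in> M" and M: "path_connected (M - {x})"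
  shows "\<exists>y. y \<notin> M \<and> is_projection M y x"
proof (cases "M = {x}")
  case True
  obtain y where "y \<noteq> x"
    using assms(2) by metis
  then show ?thesis
    using True by (intro exI[of _ y]) (auto intro: is_projectionI)
next
  case False
  then obtain m where m: "m \<in> M" "m \<noteq> x"
    using assms(4) by blast
  have "\<not> path_connected (- {x})"
    using cut m(2) by (auto simp: cut_point_def Compl_eq_Diff_UNIV)
  then obtain y where y: "y \<noteq> x" "\<not> path_component (- {x}) m y"
    unfolding path_connected_component
    by (metis ComplD path_component_sym path_component_trans singletonI)
  have sep: "\<not> path_component (- {x}) y z" if "z \<in> M" "z \<noteq> x" for z
  proof -
    have "path_component (- {x}) m z"
      by (rule path_component_path_connected[OF M]) (use m that in auto)
    then show ?thesis
      using y(2) path_component_sym path_component_trans by metis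
  qed
  have "y \<notin> M"
    using sep[of y] y(1) path_component_refl[of y "- {x}"] by auto
  moreover have "is_projection M y x"
  proof (rule is_projectionI[OF assms(4)])
    fix z assume "z \<in> M" "z \<noteq> x"
    then show "dist y x < dist y z"
      using dist_add_if_separated[OF geo sep] by simp
  qed
  ultimately show ?thesis by blast
qed

theorem lemma2p31:
  assumes "geodesic_set (UNIV :: 'a::complete_space set)"
    and "\<exists>x y :: 'a. x \<noteq> y"
  shows
    "(\<forall>C :: 'a set. C \<noteq> {} \<and> (\<forall>c\<in>C. cut_point UNIV c) \<longrightarrow>
        (\<exists>!P. largest_cut_free_grading C P) \<and>
        (\<forall>P. largest_cut_free_grading C P \<longrightarrow>
           (\<forall>M\<in>P. \<forall>N\<in>P. M \<noteq> N \<longrightarrow> M \<inter> N = {} \<or> (\<exists>c\<in>C. M \<inter> N = {c}))))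
     \<and>
     (homogeneous_space TYPE('a) \<and> (\<exists>c :: 'a. cut_point UNIV c) \<longrightarrow>
        (\<forall>x :: 'a. cut_point UNIV x) \<and>
        (\<forall>P. largest_cut_free_grading (UNIV :: 'a set) P \<longrightarrow>
           (\<forall>M\<in>P. \<forall>x\<in>M. \<exists>y. y \<notin> M \<and> is_projection M y x)))"
proof (intro conjI allI impI)
  fix C :: "'a set"
  show "\<exists>!P. largest_cut_free_grading C P"
    by (simp add: largest_cut_free_grading_iff_blocks[OF assms(1)])
next
  fix C :: "'a set" and P
  assume "largest_cut_free_grading C P"
  then have P: "P = blocks C"
    by (simp add: largest_cut_free_grading_iff_blocks[OF assms(1)])
  show "\<forall>M\<in>P. \<forall>N\<in>P. M \<noteq> N \<longrightarrow> M \<inter> N = {} \<or> (\<exists>c\<in>C. M \<inter> N = {c})"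
  proof (intro ballI impI)
    fix M N assume MN: "M \<in> P" "N \<in> P" "M \<noteq> N"
    have "\<exists>c\<in>C. M \<inter> N = {c}" if "x \<in> M \<inter> N" for x
      using distinct_blocks_Int[OF _ _ MN(3) that] MN(1,2) P by blast
    then show "M \<inter> N = {} \<or> (\<exists>c\<in>C. M \<inter> N = {c})"
      by blast
  qed
next
  fix x :: 'a
  assume "homogeneous_space TYPE('a) \<and> (\<exists>c :: 'a. cut_point UNIV c)"
  then show "cut_point UNIV x"
    by (auto intro: homogeneous_cut_point)
next
  fix P :: "'a set set"
  assume hom: "homogeneous_space TYPE('a) \<and> (\<exists>c :: 'a. cut_point UNIV c)"
    and P: "largest_cut_free_grading UNIV P"
  have cut: "cut_point UNIV x" for x :: 'a
    using hom by (auto intro: homogeneous_cut_point)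
  show "\<forall>M\<in>P. \<forall>x\<in>M. \<exists>y. y \<notin> M \<and> is_projection M y x"
  proof (intro ballI)
    fix M x assume "M \<in> P" "x \<in> M"
    moreover have "path_connected (M - {x})"
      using block_diff_path_connected[of M UNIV x] P \<open>M \<in> P\<close>
      by (simp add: largest_cut_free_grading_iff_blocks[OF assms(1)])
    ultimately show "\<exists>y. y \<notin> M \<and> is_projection M y x"
      by (intro cut_point_is_projection[OF assms cut])
  qed
qed

end
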